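(* For any selection probability $r\in(0,1)$, the Markov chain $\{(\tilde X_n,\tilde Y_n)\}_{n=0}^\infty$ on $\mathsf{X}\times\mathsf{Y}$ underlying the hybrid scan sandwich (HSS) algorithm is reversible with respect to $f_{X,Y}$.
   Context: Let $f(x,y,z)$ be a joint probability density (with respect to Lebesgue measure) on $\mathsf{X}\times\mathsf{Y}\times\mathsf{Z}$, and let $f_{X,Y}$, $f_{X|Y,Z}$, $f_{Y|X,Z}$, $f_{Z|X,Y}$, $f_{Z|Y}$, $f_{Z|X}$, etc. denote the associated marginal and conditional densities. The target density is $f_{X,Y}$. For each fixed $y\in\mathsf{Y}$, let $R_1(z,dz';y)$ be a Markov transition function on $\mathsf{Z}$ that is reversible with respect to $f_{Z|Y}(\cdot|y)$, i.e. $R_1(z,dz';y)f_{Z|Y}(z|y)\,dz=R_1(z',dz;y)f_{Z|Y}(z'|y)\,dz'$. For each fixed $x\in\mathsf{X}$, let $R_2(z,dz';x)$ be a Markov transition function on $\mathsf{Z}$ that is reversible with respect to $f_{Z|X}(\cdot|x)$. Define $$k_1(x'|x;y)=\int_{\mathsf Z}\int_{\mathsf Z}f_{X|Y,Z}(x'|y,z')\,R_1(z,dz';y)\,f_{Z|X,Y}(z|x,y)\,dz,$$ $$k_2(y'|y;x)=\int_{\mathsf Z}\int_{\mathsf Z}f_{Y|X,Z}(y'|x,z')\,R_2(z,dz';x)\,f_{Z|X,Y}(z|x,y)\,dz.$$ HSS algorithm with selection probability $r$: from the current state $(x,y)$, draw $z\sim f_{Z|X,Y}(\cdot|x,y)$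 and, independently, $W\sim\mathrm{Uniform}(0,1)$. If $W\le r$, draw $z'\sim R_1(z,\cdot;y)$, then $X^*\sim f_{X|Y,Z}(\cdot|y,z')$, and move to $(X^*,y)$; otherwise draw $z'\sim R_2(z,\cdot;x)$, then $Y^*\sim f_{Y|X,Z}(\cdot|x,z')$, and move to $(x,Y^* )$. Equivalently, with probability $r$ the $x$-component is updated using $k_1(\cdot|x;y)$ with $y$ fixed, and with probability $1-r$ the $y$-component is updated using $k_2(\cdot|y;x)$ with $x$ fixed. *)

theory Defs
  imports "HOL-Probability.Probability"
begin

abbreviation lborel_on :: "'a::euclidean_space set \<Rightarrow> 'a measure" where
  "lborel_on S \<equiv> restrict_space lborel S"

definition prob_density :: "'a measure \<Rightarrow> ('a \<Rightarrow> ennreal) \<Rightarrow> bool" where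
  "prob_density M f \<longleftrightarrow> f \<in> borel_measurable M \<and> (\<integral>\<^sup>+x. f x \<partial>M) = 1"

text \<open>
  \<^term>\<open>cond_density N M j g\<close>: if \<^term>\<open>j u v\<close> is the joint density of \<open>(U, V)\<close> with
  respect to the product of \<^term>\<open>N\<close> and \<^term>\<open>M\<close>, then \<^term>\<open>g u v\<close> is the conditional
  density of \<open>V\<close> at \<open>v\<close> given \<open>U = u\<close>. It is the quotient of the joint and the marginal
  density wherever the marginal is positive and finite. On the remaining values of \<open>u\<close>, which
  have probability zero under the law of \<open>U\<close>, the quotient is meaningless and any probability
  density is allowed, so that sampling from \<^term>\<open>g u\<close> makes sense for every \<open>u\<close>.
\<close>

definition cond_density ::
  "'u measure \<Rightarrow> 'v measure \<Rightarrow> ('u \<Rightarrow> 'v \<Rightarrow> ennreal) \<Rightarrow> ('u \<Rightarrow> 'v \<Rightarrow> ennreal) \<Rightarrow> bool" where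
  "cond_density N M j g \<longleftrightarrow>
     (\<lambda>(u, v). g u v) \<in> borel_measurable (N \<Otimes>\<^sub>M M) \<and>
     (\<forall>u\<in>space N. prob_density M (g u)) \<and>
     (\<forall>u\<in>space N. 0 < (\<integral>\<^sup>+v. j u v \<partial>M) \<and> (\<integral>\<^sup>+v. j u v \<partial>M) < \<infinity> \<longrightarrow>
        (\<forall>v\<in>space M. g u v = j u v / (\<integral>\<^sup>+v'. j u v' \<partial>M)))"

definition markov_kernel :: "'s measure \<Rightarrow> ('s \<Rightarrow> 's measure) \<Rightarrow> bool" where
  "markov_kernel M K \<longleftrightarrow> K \<in> M \<rightarrow>\<^sub>M prob_algebra M"

text \<open>
  Detailed balance \<open>\<pi>(ds) K(s, ds') = \<pi>(ds') K(s', ds)\<close>, as an identity of measures on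
  the product space evaluated on measurable rectangles.
\<close>

definition reversible :: "'s measure \<Rightarrow> ('s \<Rightarrow> 's measure) \<Rightarrow> bool" where
  "reversible \<pi> K \<longleftrightarrow>
     (\<forall>A\<in>sets \<pi>. \<forall>B\<in>sets \<pi>.
        (\<integral>\<^sup>+s\<in>A. emeasure (K s) B \<partial>\<pi>) = (\<integral>\<^sup>+s\<in>B. emeasure (K s) A \<partial>\<pi>))"

text \<open>
  The law of the state after one iteration started at \<open>(x, y)\<close>. The arguments \<open>fX_YZ (y, z)\<close>,
  \<open>fY_XZ (x, z)\<close> and \<open>fZ_XY (x, y)\<close> are the full conditional densities; \<open>R1 y z\<close> is the
  measure \<open>R\<^sub>1(z, \<cdot>; y)\<close> and \<open>R2 x z\<close> is the measure \<open>R\<^sub>2(z, \<cdot>; x)\<close>.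
\<close>

definition hss_kernel ::
  "'x measure \<Rightarrow> 'y measure \<Rightarrow> 'z measure \<Rightarrow>
   ('y \<times> 'z \<Rightarrow> 'x \<Rightarrow> ennreal) \<Rightarrow> ('x \<times> 'z \<Rightarrow> 'y \<Rightarrow> ennreal) \<Rightarrow> ('x \<times> 'y \<Rightarrow> 'z \<Rightarrow> ennreal) \<Rightarrow>
   ('y \<Rightarrow> 'z \<Rightarrow> 'z measure) \<Rightarrow> ('x \<Rightarrow> 'z \<Rightarrow> 'z measure) \<Rightarrow> real \<Rightarrow>
   'x \<times> 'y \<Rightarrow> ('x \<times> 'y) measure" where
  "hss_kernel MX MY MZ fX_YZ fY_XZ fZ_XY R1 R2 r = (\<lambda>(x, y).
     do {
       z \<leftarrow> density MZ (fZ_XY (x, y));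
       w \<leftarrow> uniform_measure lborel {0<..<1};
       if w \<le> r
       then do {
         z' \<leftarrow> R1 y z;
         x' \<leftarrow> density MX (fX_YZ (y, z'));
         return (MX \<Otimes>\<^sub>M MY) (x', y)
       }
       else do {
         z' \<leftarrow> R2 x z;
         y' \<leftarrow> density MY (fY_XZ (x, z'));
         return (MX \<Otimes>\<^sub>M MY) (x, y')
       }
     })"

text \<open>
  The sandwich densities \<open>k\<^sub>1(x' | x; y)\<close> and \<open>k\<^sub>2(y' | y; x)\<close>. The lemma
  \<open>emeasure_hss_kernel\<close> below confirms that the chain is the mixture which updates \<open>x\<close>
  with \<open>k1\<close> (probability \<open>r\<close>) or \<open>y\<close> with \<open>k2\<close> (probability \<open>1 - r\<close>).
\<close>

definition k1 ::
  "'z measure \<Rightarrow> ('y \<times> 'z \<Rightarrow> 'x \<Rightarrow> ennreal) \<Rightarrow> ('x \<times> 'y \<Rightarrow> 'z \<Rightarrow> ennreal) \<Rightarrow>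
   ('y \<Rightarrow> 'z \<Rightarrow> 'z measure) \<Rightarrow> 'x \<Rightarrow> 'x \<Rightarrow> 'y \<Rightarrow> ennreal" where
  "k1 MZ fX_YZ fZ_XY R1 x' x y =
     (\<integral>\<^sup>+z. (\<integral>\<^sup>+z'. fX_YZ (y, z') x' \<partial>R1 y z) * fZ_XY (x, y) z \<partial>MZ)"

definition k2 ::
  "'z measure \<Rightarrow> ('x \<times> 'z \<Rightarrow> 'y \<Rightarrow> ennreal) \<Rightarrow> ('x \<times> 'y \<Rightarrow> 'z \<Rightarrow> ennreal) \<Rightarrow>
   ('x \<Rightarrow> 'z \<Rightarrow> 'z measure) \<Rightarrow> 'y \<Rightarrow> 'y \<Rightarrow> 'x \<Rightarrow> ennreal" where
  "k2 MZ fY_XZ fZ_XY R2 y' y x =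
     (\<integral>\<^sup>+z. (\<integral>\<^sup>+z'. fY_XZ (x, z') y' \<partial>R2 x z) * fZ_XY (x, y) z \<partial>MZ)"

lemma density_prob_algebra:
  assumes "sigma_finite_measure M"
    and g[measurable]: "(\<lambda>(u, v). g u v) \<in> borel_measurable (N \<Otimes>\<^sub>M M)"
    and p: "\<And>u. u \<in> space N \<Longrightarrow> prob_density M (g u)"
  shows "(\<lambda>u. density M (g u)) \<in> N \<rightarrow>\<^sub>M prob_algebra M"
proof -
  interpret sigma_finite_measure M by fact
  have ps: "prob_space (density M (g u))" if "u \<in> space N" for u
    using p[OF that] by (intro prob_spaceI)
      (auto simp: prob_density_def emeasure_density cong: nn_integral_cong)
  show ?thesis
  proof (rule measurable_prob_algebraI[OF ps], assumption, rule measurable_subprob_algebra)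
    fix u assume "u \<in> space N"
    then show "subprob_space (density M (g u))" using ps prob_space_imp_subprob_space by blast
  next
    fix A assume [measurable]: "A \<in> sets M"
    have "(\<lambda>u. \<integral>\<^sup>+v. g u v * indicator A v \<partial>M) \<in> borel_measurable N"
      by measurable
    also have "?this \<longleftrightarrow> (\<lambda>u. emeasure (density M (g u)) A) \<in> borel_measurable N"
      using p by (intro measurable_cong) (auto simp: emeasure_density prob_density_def)
    finally show "(\<lambda>u. emeasure (density M (g u)) A) \<in> borel_measurable N" .
  qed simp
qed

lemma emeasure_sandwich_move:
  assumes sf: "sigma_finite_measure MV" "sigma_finite_measure MZ"
    and g: "(\<lambda>(z, v). g z v) \<in> borel_measurable (MZ \<Otimes>\<^sub>M MV)" "\<And>z. z \<in> space MZ \<Longrightarrow> prob_density MV (g z)"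
    and h: "prob_density MZ h"
    and R[measurable]: "R \<in> MZ \<rightarrow>\<^sub>M prob_algebra MZ"
    and p[measurable]: "p \<in> MV \<rightarrow>\<^sub>M S" and A[measurable]: "A \<in> sets S"
  shows "(\<lambda>z. R z \<bind> (\<lambda>z'. density MV (g z') \<bind> (\<lambda>v. return S (p v)))) \<in> MZ \<rightarrow>\<^sub>M prob_algebra S" (is ?M)
    and "(\<integral>\<^sup>+z. emeasure (R z \<bind> (\<lambda>z'. density MV (g z') \<bind> (\<lambda>v. return S (p v)))) A \<partial>density MZ h) =
      (\<integral>\<^sup>+v. indicator A (p v) * (\<integral>\<^sup>+z. (\<integral>\<^sup>+z'. g z' v \<partial>R z) * h z \<partial>MZ) \<partial>MV)"
proof -
  interpret V: sigma_finite_measure MV by fact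
  interpret Z: sigma_finite_measure MZ by fact
  note g(1)[measurable]
  have D[measurable]: "(\<lambda>z. density MV (g z)) \<in> MZ \<rightarrow>\<^sub>M prob_algebra MV"
    by (rule density_prob_algebra) (use sf g in auto)
  have [measurable]: "h \<in> borel_measurable MZ" using h by (simp add: prob_density_def)
  have I[measurable]: "(\<lambda>z'. density MV (g z') \<bind> (\<lambda>v. return S (p v))) \<in> MZ \<rightarrow>\<^sub>M prob_algebra S"
    by measurable
  show ?M by measurable
  have Rs: "R z \<in> space (prob_algebra MZ)" "sets (R z) = sets MZ" "space (R z) = space MZ" "prob_space (R z)"
    if "z \<in> space MZ" for z
    using measurable_space[OF R that] by (auto simp: space_prob_algebra dest: sets_eq_imp_space_eq)
  have inner: "emeasure (density MV (g z') \<bind> (\<lambda>v. return S (p v))) A = (\<integral>\<^sup>+v. g z' v * indicator A (p v) \<partial>MV)"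
    if z': "z' \<in> space MZ" for z'
  proof -
    have [measurable]: "g z' \<in> borel_measurable MV" using g(2)[OF z'] by (simp add: prob_density_def)
    have "emeasure (density MV (g z') \<bind> (\<lambda>v. return S (p v))) A
       = (\<integral>\<^sup>+v. emeasure (return S (p v)) A \<partial>density MV (g z'))"
      by (rule emeasure_bind_prob_algebra[OF measurable_space[OF D z']]) measurable
    also have "\<dots> = (\<integral>\<^sup>+v. indicator A (p v) \<partial>density MV (g z'))"
      by (intro nn_integral_cong) (auto simp: A)
    also have "\<dots> = (\<integral>\<^sup>+v. g z' v * indicator A (p v) \<partial>MV)"
      by (subst nn_integral_density) auto
    finally show ?thesis .
  qed
  have mid: "emeasure (R z \<bind> (\<lambda>z'. density MV (g z') \<bind> (\<lambda>v. return S (p v)))) A =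
      (\<integral>\<^sup>+v. indicator A (p v) * (\<integral>\<^sup>+z'. g z' v \<partial>R z) \<partial>MV)" if z: "z \<in> space MZ" for z
  proof -
    note Rz = Rs[OF z]
    note Rz(2)[measurable_cong]
    interpret Rz: prob_space "R z" by fact
    interpret P: pair_sigma_finite MV "R z" ..
    have "emeasure (R z \<bind> (\<lambda>z'. density MV (g z') \<bind> (\<lambda>v. return S (p v)))) A =
       (\<integral>\<^sup>+z'. emeasure (density MV (g z') \<bind> (\<lambda>v. return S (p v))) A \<partial>R z)"
      by (rule emeasure_bind_prob_algebra[OF Rz(1)]) measurable
    also have "\<dots> = (\<integral>\<^sup>+z'. (\<integral>\<^sup>+v. g z' v * indicator A (p v) \<partial>MV) \<partial>R z)"
      by (intro nn_integral_cong inner) (simp add: Rz)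
    also have "\<dots> = (\<integral>\<^sup>+v. (\<integral>\<^sup>+z'. g z' v * indicator A (p v) \<partial>R z) \<partial>MV)"
      by (rule P.Fubini') measurable
    also have "\<dots> = (\<integral>\<^sup>+v. indicator A (p v) * (\<integral>\<^sup>+z'. g z' v \<partial>R z) \<partial>MV)"
      by (intro nn_integral_cong) (simp add: nn_integral_multc mult.commute)
    finally show ?thesis .
  qed
  interpret P: pair_sigma_finite MV MZ ..
  have J[measurable]: "(\<lambda>(z, v). \<integral>\<^sup>+z'. g z' v \<partial>R z) \<in> borel_measurable (MZ \<Otimes>\<^sub>M MV)"
    unfolding split_beta'
    by (rule nn_integral_measurable_subprob_algebra2[where N=MZ]) (measurable, rule measurable_prob_algebraD, measurable)
  have "(\<integral>\<^sup>+z. emeasure (R z \<bind> (\<lambda>z'. density MV (g z') \<bind> (\<lambda>v. return S (p v)))) A \<partial>density MZ h) =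
     (\<integral>\<^sup>+z. (\<integral>\<^sup>+v. indicator A (p v) * (\<integral>\<^sup>+z'. g z' v \<partial>R z) \<partial>MV) \<partial>density MZ h)"
    by (intro nn_integral_cong mid) simp
  also have "\<dots> = (\<integral>\<^sup>+z. h z * (\<integral>\<^sup>+v. indicator A (p v) * (\<integral>\<^sup>+z'. g z' v \<partial>R z) \<partial>MV) \<partial>MZ)"
    by (subst nn_integral_density) auto
  also have "\<dots> = (\<integral>\<^sup>+z. (\<integral>\<^sup>+v. h z * (indicator A (p v) * (\<integral>\<^sup>+z'. g z' v \<partial>R z)) \<partial>MV) \<partial>MZ)"
    by (intro nn_integral_cong nn_integral_cmult[symmetric]) measurable
  also have "\<dots> = (\<integral>\<^sup>+v. (\<integral>\<^sup>+z. h z * (indicator A (p v) * (\<integral>\<^sup>+z'. g z' v \<partial>R z)) \<partial>MZ) \<partial>MV)"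
    by (rule P.Fubini') measurable
  also have "\<dots> = (\<integral>\<^sup>+v. indicator A (p v) * (\<integral>\<^sup>+z. (\<integral>\<^sup>+z'. g z' v \<partial>R z) * h z \<partial>MZ) \<partial>MV)"
    by (intro nn_integral_cong) (subst nn_integral_cmult[symmetric], measurable, simp add: ac_simps)
  finally show "(\<integral>\<^sup>+z. emeasure (R z \<bind> (\<lambda>z'. density MV (g z') \<bind> (\<lambda>v. return S (p v)))) A \<partial>density MZ h) = \<dots>" .
qed

lemma emeasure_hss_kernel:
  assumes sf: "sigma_finite_measure MX" "sigma_finite_measure MY" "sigma_finite_measure MZ"
    and X: "cond_density (MY \<Otimes>\<^sub>M MZ) MX jX fX_YZ"
    and Y: "cond_density (MX \<Otimes>\<^sub>M MZ) MY jY fY_XZ"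
    and Z: "cond_density (MX \<Otimes>\<^sub>M MY) MZ jZ fZ_XY"
    and R1: "(\<lambda>(y, z). R1 y z) \<in> MY \<Otimes>\<^sub>M MZ \<rightarrow>\<^sub>M prob_algebra MZ"
    and R2: "(\<lambda>(x, z). R2 x z) \<in> MX \<Otimes>\<^sub>M MZ \<rightarrow>\<^sub>M prob_algebra MZ"
    and r: "0 < r" "r < 1"
    and x[simp]: "x \<in> space MX" and y[simp]: "y \<in> space MY"
    and A[measurable]: "A \<in> sets (MX \<Otimes>\<^sub>M MY)"
  shows "emeasure (hss_kernel MX MY MZ fX_YZ fY_XZ fZ_XY R1 R2 r (x, y)) A =
     ennreal r * (\<integral>\<^sup>+x'. indicator A (x', y) * k1 MZ fX_YZ fZ_XY R1 x' x y \<partial>MX) +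
     ennreal (1 - r) * (\<integral>\<^sup>+y'. indicator A (x, y') * k2 MZ fY_XZ fZ_XY R2 y' y x \<partial>MY)"
proof -
  have h: "prob_density MZ (fZ_XY (x, y))"
    using Z by (auto simp: cond_density_def space_pair_measure)
  have gX: "(\<lambda>(z, v). fX_YZ (y, z) v) \<in> borel_measurable (MZ \<Otimes>\<^sub>M MX)"
    "\<And>z. z \<in> space MZ \<Longrightarrow> prob_density MX (fX_YZ (y, z))"
    and gY: "(\<lambda>(z, v). fY_XZ (x, z) v) \<in> borel_measurable (MZ \<Otimes>\<^sub>M MY)"
    "\<And>z. z \<in> space MZ \<Longrightarrow> prob_density MY (fY_XZ (x, z))"
    using X Y measurable_compose[of "\<lambda>(z, v). ((y, z), v)" "MZ \<Otimes>\<^sub>M MX" "(MY \<Otimes>\<^sub>M MZ) \<Otimes>\<^sub>M MX" "\<lambda>(u, v). fX_YZ u v" borel]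
      measurable_compose[of "\<lambda>(z, v). ((x, z), v)" "MZ \<Otimes>\<^sub>M MY" "(MX \<Otimes>\<^sub>M MZ) \<Otimes>\<^sub>M MY" "\<lambda>(u, v). fY_XZ u v" borel]
    by (auto simp: cond_density_def space_pair_measure split_beta')
  have R1y[measurable]: "R1 y \<in> MZ \<rightarrow>\<^sub>M prob_algebra MZ" and R2x[measurable]: "R2 x \<in> MZ \<rightarrow>\<^sub>M prob_algebra MZ"
    using measurable_compose[OF measurable_Pair1'[OF y] R1] measurable_compose[OF measurable_Pair1'[OF x] R2] by auto
  have pX: "(\<lambda>x'. (x', y)) \<in> MX \<rightarrow>\<^sub>M MX \<Otimes>\<^sub>M MY" and pY: "(\<lambda>y'. (x, y')) \<in> MY \<rightarrow>\<^sub>M MX \<Otimes>\<^sub>M MY"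
    by auto
  define B1 where "B1 z = R1 y z \<bind> (\<lambda>z'. density MX (fX_YZ (y, z')) \<bind> (\<lambda>x'. return (MX \<Otimes>\<^sub>M MY) (x', y)))" for z
  define B2 where "B2 z = R2 x z \<bind> (\<lambda>z'. density MY (fY_XZ (x, z')) \<bind> (\<lambda>y'. return (MX \<Otimes>\<^sub>M MY) (x, y')))" for z
  note S1 = emeasure_sandwich_move[OF sf(1,3) gX h R1y pX A, folded B1_def]
  note S2 = emeasure_sandwich_move[OF sf(2,3) gY h R2x pY A, folded B2_def]
  note S1(1)[measurable] S2(1)[measurable]
  define U :: "real measure" where "U = uniform_measure lborel {0<..<1}"
  have U: "prob_space U" and [measurable_cong]: "sets U = sets borel"
    by (auto simp: U_def intro!: prob_space_uniform_measure)
  interpret U: prob_space U by fact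
  have Ur: "emeasure U {w. w \<le> r} = ennreal r" "emeasure U {w. \<not> w \<le> r} = ennreal (1 - r)"
  proof -
    have "{0<..<1} \<inter> {w. w \<le> r} = {0<..r}" "{0<..<1} \<inter> {w. \<not> w \<le> r} = {r<..<1}" using r by auto
    then show "emeasure U {w. w \<le> r} = ennreal r" "emeasure U {w. \<not> w \<le> r} = ennreal (1 - r)"
      using r by (auto simp: U_def divide_ennreal_def)
  qed
  have Us: "U \<in> space (prob_algebra borel)" 
    using U by (simp add: space_prob_algebra U_def)
  have step: "emeasure (U \<bind> (\<lambda>w. if w \<le> r then B1 z else B2 z)) A =
     ennreal r * emeasure (B1 z) A + ennreal (1 - r) * emeasure (B2 z) A" if z: "z \<in> space MZ" for z
  proof -
    have [simp]: "space U = UNIV" by (simp add: U_def)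
    have z1: "B1 z \<in> space (prob_algebra (MX \<Otimes>\<^sub>M MY))" "B2 z \<in> space (prob_algebra (MX \<Otimes>\<^sub>M MY))"
      using measurable_space[OF S1(1) z] measurable_space[OF S2(1) z] by auto
    have "emeasure (U \<bind> (\<lambda>w. if w \<le> r then B1 z else B2 z)) A =
      (\<integral>\<^sup>+w. emeasure (if w \<le> r then B1 z else B2 z) A \<partial>U)"
      by (rule emeasure_bind_prob_algebra[OF Us _ A]) (use z1 in measurable)
    also have "\<dots> = (\<integral>\<^sup>+w. emeasure (B1 z) A * indicator {w. w \<le> r} w + emeasure (B2 z) A * indicator {w. \<not> w \<le> r} w \<partial>U)"
      by (intro nn_integral_cong) auto
    also have "\<dots> = emeasure (B1 z) A * emeasure U {w. w \<le> r} + emeasure (B2 z) A * emeasure U {w. \<not> w \<le> r}"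
      by (subst nn_integral_add) (auto simp: nn_integral_cmult_indicator)
    finally show ?thesis by (simp add: Ur mult.commute)
  qed
  have hs: "density MZ (fZ_XY (x, y)) \<in> space (prob_algebra MZ)"
    using h by (auto simp: space_prob_algebra prob_density_def emeasure_density intro!: prob_spaceI cong: nn_integral_cong)
  have [measurable]: "fZ_XY (x, y) \<in> borel_measurable MZ" using h by (simp add: prob_density_def)
  have "hss_kernel MX MY MZ fX_YZ fY_XZ fZ_XY R1 R2 r (x, y) =
      density MZ (fZ_XY (x, y)) \<bind> (\<lambda>z. U \<bind> (\<lambda>w. if w \<le> r then B1 z else B2 z))"
    unfolding hss_kernel_def B1_def B2_def U_def by simp
  also have "emeasure \<dots> A = (\<integral>\<^sup>+z. emeasure (U \<bind> (\<lambda>w. if w \<le> r then B1 z else B2 z)) A \<partial>density MZ (fZ_XY (x, y)))"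
  proof (rule emeasure_bind_prob_algebra[OF hs _ A])
    have [measurable]: "(\<lambda>_. U) \<in> MZ \<rightarrow>\<^sub>M prob_algebra borel" using Us by (rule measurable_const)
    show "(\<lambda>z. U \<bind> (\<lambda>w. if w \<le> r then B1 z else B2 z)) \<in> MZ \<rightarrow>\<^sub>M prob_algebra (MX \<Otimes>\<^sub>M MY)"
      by measurable
  qed
  also have "\<dots> = (\<integral>\<^sup>+z. ennreal r * emeasure (B1 z) A + ennreal (1 - r) * emeasure (B2 z) A \<partial>density MZ (fZ_XY (x, y)))"
    by (intro nn_integral_cong step) simp
  also have "\<dots> = ennreal r * (\<integral>\<^sup>+z. emeasure (B1 z) A \<partial>density MZ (fZ_XY (x, y)))
       + ennreal (1 - r) * (\<integral>\<^sup>+z. emeasure (B2 z) A \<partial>density MZ (fZ_XY (x, y)))"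
  proof -
    have [measurable]: "(\<lambda>z. emeasure (B1 z) A) \<in> borel_measurable MZ" "(\<lambda>z. emeasure (B2 z) A) \<in> borel_measurable MZ"
      using measurable_compose[OF measurable_prob_algebraD[OF S1(1)] measurable_emeasure_subprob_algebra[OF A]]
        measurable_compose[OF measurable_prob_algebraD[OF S2(1)] measurable_emeasure_subprob_algebra[OF A]] by auto
    show ?thesis by (simp add: nn_integral_add nn_integral_cmult)
  qed
  finally show ?thesis by (simp add: S1(2) S2(2) k1_def k2_def)
qed

end

theory Submission
  imports Defs
begin

text \<open>
  Each of the two moves is a sandwich: a Gibbs draw of \<open>z\<close>, a step \<open>z \<rightarrow> z'\<close> of a chain that is
  reversible for the law of \<open>z\<close>, and a Gibbs draw of the component that moves. Fix the component
  \<open>u\<close> that stays put, let \<open>v\<close> be the one that moves, and write \<open>j(u, v, z)\<close> for the joint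
  density. Under stationarity the mass that one move carries from \<open>a(v)\<close> to \<open>b(v')\<close> is the
  integral of \<open>a(v) j(u, v, z) R(z, dz'; u) k(v' | u, z') b(v')\<close>, because the marginal density
  of \<open>(u, v)\<close> times the conditional density of \<open>z\<close> is the joint density. Factoring the same joint
  density in the other order, \<open>j(u, v, z) = j(u) p(z | u) k(v | u, z)\<close>, turns this into
  \<open>j(u) \<integral>\<integral> \<phi>\<^sub>a(z) p(z | u) R(z, dz'; u) \<phi>\<^sub>b(z') dz\<close>, with \<open>\<phi>\<^sub>e(z)\<close> the conditional mean of
  \<open>e(v)\<close> given \<open>(u, z)\<close>. Reversibility of \<open>R\<close> makes this form symmetric in \<open>a\<close> and \<open>b\<close>.

  The flow of the whole chain from \<open>A\<close> to \<open>B\<close> is the mixture, with weights \<open>r\<close> and \<open>1 - r\<close>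
  that do not depend on the state, of the flows of the two moves. Each of these is obtained by
  applying the symmetric form to the sections of \<open>A\<close> and \<open>B\<close> and integrating over the fixed
  component. So detailed balance of the moves gives detailed balance of the chain.

  The conditional densities are arbitrary where the marginal vanishes or is infinite, so the
  two factorisations hold only almost everywhere (\<open>marginal_times_cond_density\<close>), and
  the symmetry of the form holds for almost every \<open>u\<close> (\<open>sandwich_move_detailed_balance\<close>).
  The remaining ingredients are the extension of detailed balance from sets to nonnegative
  functions (\<open>reversible_nn_integral\<close>) and the computation of the form
  (\<open>nn_integral_sandwich_move\<close>).
\<close>

section \<open>Factorisation of a joint density\<close>

text \<open>
  Where the marginal is positive and finite this is the defining quotient. Where it vanishes, the
  joint density is null in \<open>v\<close>, whatever density was chosen for the conditional there. An
  infinite marginal is excluded almost everywhere by finite total mass.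
\<close>

lemma marginal_times_cond_density:
  assumes "sigma_finite_measure M"
    and j[measurable]: "(\<lambda>(u, v). j u v) \<in> borel_measurable (N \<Otimes>\<^sub>M M)"
    and fin: "(\<integral>\<^sup>+u. \<integral>\<^sup>+v. j u v \<partial>M \<partial>N) \<noteq> \<infinity>"
    and g: "cond_density N M j g"
  shows "AE u in N. AE v in M. (\<integral>\<^sup>+v'. j u v' \<partial>M) * g u v = j u v"
proof -
  interpret sigma_finite_measure M by fact
  have "AE u in N. (\<integral>\<^sup>+v. j u v \<partial>M) \<noteq> \<infinity>"
    by (rule nn_integral_PInf_AE[OF _ fin]) measurable
  with AE_space show ?thesis
  proof eventually_elim
    case (elim u)
    note [measurable] = elim(1)
    show ?case
    proof (cases "(\<integral>\<^sup>+v. j u v \<partial>M) = 0")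
      case True
      then have "AE v in M. j u v = 0"
        by (subst (asm) nn_integral_0_iff_AE) measurable
      then show ?thesis
        by eventually_elim (simp add: True)
    next
      case False
      have "(\<integral>\<^sup>+v'. j u v' \<partial>M) * g u v = j u v" if "v \<in> space M" for v
      proof -
        have "g u v = j u v / (\<integral>\<^sup>+v'. j u v' \<partial>M)"
          using g elim False that by (simp add: cond_density_def zero_less_iff_neq_zero less_top)
        then show ?thesis
          using elim(2) False
          by (simp add: ennreal_times_divide mult.commute[of _ "j u v"] ennreal_mult_divide_eq)
      qed
      then show ?thesis by (rule AE_I2)
    qed
  qed
qed

text \<open>
  The law of \<open>z\<close> is conditioned on a pair. The swap lets the move of either component
  treat the one that stays put as the first of the pair.
\<close>

lemma cond_density_swap:
  assumes "cond_density (M \<Otimes>\<^sub>M N) L (\<lambda>(u, v). j u v) (\<lambda>(u, v). g u v)"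
  shows "cond_density (N \<Otimes>\<^sub>M M) L (\<lambda>(v, u). j u v) (\<lambda>(v, u). g u v)"
proof -
  have "(\<lambda>(w, z). (\<lambda>(u, v). g u v) w z) \<in> borel_measurable ((M \<Otimes>\<^sub>M N) \<Otimes>\<^sub>M L)"
    using assms unfolding cond_density_def by blast
  from measurable_compose[OF _ this, of "\<lambda>((v, u), z). ((u, v), z)" "(N \<Otimes>\<^sub>M M) \<Otimes>\<^sub>M L"]
  have "(\<lambda>(w, z). (\<lambda>(v, u). g u v) w z) \<in> borel_measurable ((N \<Otimes>\<^sub>M M) \<Otimes>\<^sub>M L)"
    by (simp add: split_beta')
  then show ?thesis
    using assms by (auto simp: cond_density_def space_pair_measure)
qed

section \<open>Detailed balance for functions\<close>

text \<open>
  Approximating one of the two functions by simple functions extends the identity as soon as it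
  holds for all indicators in that argument. This is used twice, once per argument.
\<close>

lemma reversible_nn_integral:
  fixes \<phi> \<psi> :: "'s \<Rightarrow> ennreal"
  assumes K[measurable]: "K \<in> \<pi> \<rightarrow>\<^sub>M subprob_algebra \<pi>"
    and rev: "reversible \<pi> K"
    and [measurable]: "\<phi> \<in> borel_measurable \<pi>" "\<psi> \<in> borel_measurable \<pi>"
  shows "(\<integral>\<^sup>+s. \<phi> s * (\<integral>\<^sup>+t. \<psi> t \<partial>K s) \<partial>\<pi>) = (\<integral>\<^sup>+s. \<psi> s * (\<integral>\<^sup>+t. \<phi> t \<partial>K s) \<partial>\<pi>)"
proof -
  have Ks: "sets (K s) = sets \<pi>" "space (K s) = space \<pi>" if "s \<in> space \<pi>" for s
    using measurable_space[OF K that] by (auto simp: space_subprob_algebra dest: sets_eq_imp_space_eq)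
  note nn_integral_measurable_subprob_algebra[measurable]
  \<comment> \<open>Both sides are linear and monotonically continuous in \<open>\<alpha>\<close> for a fixed \<open>\<beta>\<close>. Since
    \<open>\<beta>\<close> may be any function, the same statement serves for \<open>\<beta>\<close> an indicator and for \<open>\<beta> = \<psi>\<close>.\<close>
  have extend: "(\<integral>\<^sup>+s. \<alpha> s * (\<integral>\<^sup>+t. \<beta> t \<partial>K s) \<partial>\<pi>) = (\<integral>\<^sup>+s. \<beta> s * (\<integral>\<^sup>+t. \<alpha> t \<partial>K s) \<partial>\<pi>)"
    if sets: "\<And>A. A \<in> sets \<pi> \<Longrightarrow>
        (\<integral>\<^sup>+s. indicator A s * (\<integral>\<^sup>+t. \<beta> t \<partial>K s) \<partial>\<pi>) = (\<integral>\<^sup>+s. \<beta> s * (\<integral>\<^sup>+t. indicator A t \<partial>K s) \<partial>\<pi>)"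
      and \<beta>[measurable]: "\<beta> \<in> borel_measurable \<pi>" and \<alpha>: "\<alpha> \<in> borel_measurable \<pi>"
    for \<alpha> \<beta> :: "'s \<Rightarrow> ennreal"
    using \<alpha>
  proof induction
    case (cong f g)
    have "(\<integral>\<^sup>+t. f t \<partial>K s) = (\<integral>\<^sup>+t. g t \<partial>K s)" if "s \<in> space \<pi>" for s
      by (intro nn_integral_cong) (simp add: Ks that cong)
    with cong show ?case
      by (simp cong: nn_integral_cong)
  next
    case (set A)
    then show ?case by (rule sets)
  next
    case (mult u c)
    note [measurable] = mult.hyps(2)
    have "(\<integral>\<^sup>+t. c * u t \<partial>K s) = c * (\<integral>\<^sup>+t. u t \<partial>K s)" if "s \<in> space \<pi>" for s
      by (intro nn_integral_cmult) (simp add: Ks that cong: measurable_cong_sets)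
    then show ?case
      using mult.IH
      by (simp add: nn_integral_cmult mult.assoc mult.left_commute[of _ c] cong: nn_integral_cong)
  next
    case (add u v)
    note [measurable] = add.hyps(1,3)
    have "(\<integral>\<^sup>+t. v t + u t \<partial>K s) = (\<integral>\<^sup>+t. v t \<partial>K s) + (\<integral>\<^sup>+t. u t \<partial>K s)" if "s \<in> space \<pi>" for s
      by (intro nn_integral_add) (simp_all add: Ks that cong: measurable_cong_sets)
    then show ?case
      using add.IH
      by (simp add: nn_integral_add distrib_left distrib_right cong: nn_integral_cong)
  next
    case (seq U)
    note [measurable] = seq.hyps(1)
    have "(\<integral>\<^sup>+t. (SUP i. U i) t \<partial>K s) = (SUP i. \<integral>\<^sup>+t. U i t \<partial>K s)" if "s \<in> space \<pi>" for s
      unfolding SUP_apply using seq.hyps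
      by (intro nn_integral_monotone_convergence_SUP) (simp_all add: Ks that cong: measurable_cong_sets)
    then have "(\<integral>\<^sup>+s. \<beta> s * (\<integral>\<^sup>+t. (SUP i. U i) t \<partial>K s) \<partial>\<pi>) =
        (\<integral>\<^sup>+s. (SUP i. \<beta> s * (\<integral>\<^sup>+t. U i t \<partial>K s)) \<partial>\<pi>)"
      by (simp add: SUP_mult_left_ennreal cong: nn_integral_cong)
    also have "\<dots> = (SUP i. \<integral>\<^sup>+s. \<beta> s * (\<integral>\<^sup>+t. U i t \<partial>K s) \<partial>\<pi>)"
      using seq.hyps
      by (intro nn_integral_monotone_convergence_SUP)
        (auto simp: incseq_def le_fun_def intro!: mult_left_mono nn_integral_mono)
    also have "\<dots> = (SUP i. \<integral>\<^sup>+s. U i s * (\<integral>\<^sup>+t. \<beta> t \<partial>K s) \<partial>\<pi>)"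
      by (simp add: seq.IH)
    also have "\<dots> = (\<integral>\<^sup>+s. (SUP i. U i s * (\<integral>\<^sup>+t. \<beta> t \<partial>K s)) \<partial>\<pi>)"
      using seq.hyps
      by (intro nn_integral_monotone_convergence_SUP[symmetric])
        (auto simp: incseq_def le_fun_def intro!: mult_right_mono)
    also have "\<dots> = (\<integral>\<^sup>+s. (SUP i. U i) s * (\<integral>\<^sup>+t. \<beta> t \<partial>K s) \<partial>\<pi>)"
      by (simp add: SUP_mult_right_ennreal image_comp)
    finally show ?case by simp
  qed
  have indicator_swap: "(\<integral>\<^sup>+s. \<alpha> s * (\<integral>\<^sup>+t. indicator A t \<partial>K s) \<partial>\<pi>) = (\<integral>\<^sup>+s. indicator A s * (\<integral>\<^sup>+t. \<alpha> t \<partial>K s) \<partial>\<pi>)"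
    if A[measurable]: "A \<in> sets \<pi>" and \<alpha>: "\<alpha> \<in> borel_measurable \<pi>" for A and \<alpha> :: "'s \<Rightarrow> ennreal"
  proof (rule extend[OF _ _ \<alpha>])
    fix B assume B: "B \<in> sets \<pi>"
    have "(\<integral>\<^sup>+s. indicator B s * (\<integral>\<^sup>+t. indicator A t \<partial>K s) \<partial>\<pi>) = (\<integral>\<^sup>+s\<in>B. emeasure (K s) A \<partial>\<pi>)"
      by (intro nn_integral_cong) (simp add: Ks A mult.commute)
    also have "\<dots> = (\<integral>\<^sup>+s\<in>A. emeasure (K s) B \<partial>\<pi>)"
      using rev A B by (simp add: reversible_def)
    also have "\<dots> = (\<integral>\<^sup>+s. indicator A s * (\<integral>\<^sup>+t. indicator B t \<partial>K s) \<partial>\<pi>)"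
      by (intro nn_integral_cong) (simp add: Ks B mult.commute)
    finally show "(\<integral>\<^sup>+s. indicator B s * (\<integral>\<^sup>+t. indicator A t \<partial>K s) \<partial>\<pi>) = \<dots>" .
  qed measurable
  show ?thesis
    by (rule extend[OF indicator_swap[symmetric]]) simp_all
qed

section \<open>A single sandwich move\<close>

text \<open>
  The computation of the form with the fixed component suppressed: \<open>j\<close> is the joint density of
  \<open>(v, z)\<close>, \<open>c\<close> is the marginal of \<open>v\<close>, \<open>h\<close> and \<open>k\<close> are the two conditional densities, and the
  marginal of \<open>z\<close> is \<open>d\<close> times the density \<open>p\<close>. The constant \<open>d\<close>, the marginal density at the
  fixed component, is kept apart because \<open>R\<close> is reversible with respect to \<open>p\<close>. The right-hand
  side makes the symmetry visible, as it only involves \<open>a\<close> and \<open>b\<close> through \<open>\<phi>\<^sub>a\<close>, \<open>\<phi>\<^sub>b\<close> and one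
  step of \<open>R\<close>.
\<close>

lemma nn_integral_sandwich_move:
  fixes a b c :: "'v \<Rightarrow> ennreal" and d :: ennreal
  assumes sf: "sigma_finite_measure MV" "sigma_finite_measure MZ"
    and [measurable]: "(\<lambda>(v, z). j v z) \<in> borel_measurable (MV \<Otimes>\<^sub>M MZ)"
      "(\<lambda>(v, z). h v z) \<in> borel_measurable (MV \<Otimes>\<^sub>M MZ)"
      "(\<lambda>(z, v). k z v) \<in> borel_measurable (MZ \<Otimes>\<^sub>M MV)"
      "p \<in> borel_measurable MZ" "c \<in> borel_measurable MV"
      "a \<in> borel_measurable MV" "b \<in> borel_measurable MV"
    and R[measurable]: "R \<in> MZ \<rightarrow>\<^sub>M subprob_algebra MZ"
    and h: "AE v in MV. AE z in MZ. c v * h v z = j v z"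
    and k: "AE z in MZ. AE v in MV. (\<integral>\<^sup>+v'. j v' z \<partial>MV) * k z v = j v z"
    and p: "AE z in MZ. d * p z = (\<integral>\<^sup>+v. j v z \<partial>MV)"
  shows "(\<integral>\<^sup>+v. a v * (c v * (\<integral>\<^sup>+v'. b v' * (\<integral>\<^sup>+z. (\<integral>\<^sup>+z'. k z' v' \<partial>R z) * h v z \<partial>MZ) \<partial>MV)) \<partial>MV) =
    d * (\<integral>\<^sup>+z. (\<integral>\<^sup>+v. a v * k z v \<partial>MV) * (\<integral>\<^sup>+z'. (\<integral>\<^sup>+v. b v * k z' v \<partial>MV) \<partial>R z) \<partial>density MZ p)"
proof -
  interpret V: sigma_finite_measure MV by fact
  interpret Z: sigma_finite_measure MZ by fact
  interpret VZ: pair_sigma_finite MV MZ ..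
  note nn_integral_measurable_subprob_algebra[measurable]
  have Rs: "sets (R z) = sets MZ" "space (R z) = space MZ" "subprob_space (R z)" if "z \<in> space MZ" for z
    using measurable_space[OF R that] by (auto simp: space_subprob_algebra dest: sets_eq_imp_space_eq)
  define \<phi> where "\<phi> e z = (\<integral>\<^sup>+v. e v * k z v \<partial>MV)" for e z
  define K where "K z = (\<integral>\<^sup>+z'. \<phi> b z' \<partial>R z)" for z
  have [measurable]: "\<phi> b \<in> borel_measurable MZ" "\<phi> a \<in> borel_measurable MZ"
    unfolding \<phi>_def by measurable
  have [measurable]: "K \<in> borel_measurable MZ"
    unfolding K_def by measurable
  have T[measurable]: "(\<lambda>(z, v). \<integral>\<^sup>+z'. k z' v \<partial>R z) \<in> borel_measurable (MZ \<Otimes>\<^sub>M MV)"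
    unfolding split_beta' by (rule nn_integral_measurable_subprob_algebra2[where N=MZ]) measurable
  have K: "K z = (\<integral>\<^sup>+v. b v * (\<integral>\<^sup>+z'. k z' v \<partial>R z) \<partial>MV)" if z: "z \<in> space MZ" for z
  proof -
    interpret Rz: subprob_space "R z" by (rule Rs(3)[OF z])
    interpret P: pair_sigma_finite MV "R z" ..
    have "(\<lambda>(v, z'). b v * k z' v) \<in> borel_measurable (MV \<Otimes>\<^sub>M MZ)"
      by measurable
    then have [measurable]: "(\<lambda>(v, z'). b v * k z' v) \<in> borel_measurable (MV \<Otimes>\<^sub>M R z)"
      by (simp add: Rs(1)[OF z] cong: measurable_cong_sets sets_pair_measure_cong)
    have "K z = (\<integral>\<^sup>+v. (\<integral>\<^sup>+z'. b v * k z' v \<partial>R z) \<partial>MV)"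
      unfolding K_def \<phi>_def by (rule P.Fubini') fact
    also have "\<dots> = (\<integral>\<^sup>+v. b v * (\<integral>\<^sup>+z'. k z' v \<partial>R z) \<partial>MV)"
      by (intro nn_integral_cong nn_integral_cmult) (simp add: Rs(1)[OF z] cong: measurable_cong_sets)
    finally show ?thesis .
  qed
  have inner: "(\<integral>\<^sup>+v'. b v' * (\<integral>\<^sup>+z. (\<integral>\<^sup>+z'. k z' v' \<partial>R z) * h v z \<partial>MZ) \<partial>MV) = (\<integral>\<^sup>+z. h v z * K z \<partial>MZ)"
    if v: "v \<in> space MV" for v
  proof -
    have "(\<integral>\<^sup>+v'. b v' * (\<integral>\<^sup>+z. (\<integral>\<^sup>+z'. k z' v' \<partial>R z) * h v z \<partial>MZ) \<partial>MV) =
        (\<integral>\<^sup>+v'. (\<integral>\<^sup>+z. h v z * (b v' * (\<integral>\<^sup>+z'. k z' v' \<partial>R z)) \<partial>MZ) \<partial>MV)"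
      using v by (intro nn_integral_cong) (subst nn_integral_cmult[symmetric], measurable, simp add: ac_simps)
    also have "\<dots> = (\<integral>\<^sup>+z. (\<integral>\<^sup>+v'. h v z * (b v' * (\<integral>\<^sup>+z'. k z' v' \<partial>R z)) \<partial>MV) \<partial>MZ)"
      using v by (intro VZ.Fubini'[symmetric]) measurable
    also have "\<dots> = (\<integral>\<^sup>+z. h v z * K z \<partial>MZ)"
      by (intro nn_integral_cong) (subst nn_integral_cmult, measurable, simp add: K)
    finally show ?thesis .
  qed
  have "(\<integral>\<^sup>+v. a v * (c v * (\<integral>\<^sup>+v'. b v' * (\<integral>\<^sup>+z. (\<integral>\<^sup>+z'. k z' v' \<partial>R z) * h v z \<partial>MZ) \<partial>MV)) \<partial>MV) =
      (\<integral>\<^sup>+v. (\<integral>\<^sup>+z. a v * (c v * h v z) * K z \<partial>MZ) \<partial>MV)"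
    by (intro nn_integral_cong)
      (simp add: inner nn_integral_cmult[symmetric] mult.assoc)
  also have "\<dots> = (\<integral>\<^sup>+v. (\<integral>\<^sup>+z. a v * j v z * K z \<partial>MZ) \<partial>MV)"
  proof (rule nn_integral_cong_AE, use h in eventually_elim, rule nn_integral_cong_AE)
    fix v assume "AE z in MZ. c v * h v z = j v z"
    then show "AE z in MZ. a v * (c v * h v z) * K z = a v * j v z * K z"
      by eventually_elim simp
  qed
  also have "\<dots> = (\<integral>\<^sup>+z. (\<integral>\<^sup>+v. a v * j v z * K z \<partial>MV) \<partial>MZ)"
    by (rule VZ.Fubini'[symmetric]) measurable
  also have "\<dots> = (\<integral>\<^sup>+z. d * (p z * (\<phi> a z * K z)) \<partial>MZ)"
  proof (rule nn_integral_cong_AE)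
    from k p AE_space show "AE z in MZ. (\<integral>\<^sup>+v. a v * j v z * K z \<partial>MV) = d * (p z * (\<phi> a z * K z))"
    proof eventually_elim
      case (elim z)
      note [measurable] = elim(3)
      have "(\<integral>\<^sup>+v. a v * j v z * K z \<partial>MV) = (\<integral>\<^sup>+v. (d * p z * K z) * (a v * k z v) \<partial>MV)"
        by (rule nn_integral_cong_AE, use elim(1) in eventually_elim) (simp add: elim(2) ac_simps)
      also have "\<dots> = d * (p z * (\<phi> a z * K z))"
        by (subst nn_integral_cmult, measurable) (simp add: \<phi>_def ac_simps)
      finally show ?case .
    qed
  qed
  also have "\<dots> = d * (\<integral>\<^sup>+z. \<phi> a z * K z \<partial>density MZ p)"
    by (simp add: nn_integral_cmult nn_integral_density)
  finally show ?thesis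
    by (simp add: \<phi>_def K_def)
qed

text \<open>
  The exceptional null set of \<open>u\<close> must not depend on \<open>a\<close> and \<open>b\<close>: they are later taken to be
  sections at \<open>u\<close> and so vary with \<open>u\<close>. Hence the quantifiers over them stand inside.
\<close>

lemma sandwich_move_detailed_balance:
  fixes j :: "'u \<Rightarrow> 'v \<Rightarrow> 'z \<Rightarrow> ennreal"
  assumes sf: "sigma_finite_measure MU" "sigma_finite_measure MV" "sigma_finite_measure MZ"
    and j[measurable]: "(\<lambda>(u, v, z). j u v z) \<in> borel_measurable (MU \<Otimes>\<^sub>M MV \<Otimes>\<^sub>M MZ)"
    and fin: "(\<integral>\<^sup>+u. \<integral>\<^sup>+v. \<integral>\<^sup>+z. j u v z \<partial>MZ \<partial>MV \<partial>MU) \<noteq> \<infinity>"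
    and k: "cond_density (MU \<Otimes>\<^sub>M MZ) MV (\<lambda>(u, z) v. j u v z) k"
    and h: "cond_density (MU \<Otimes>\<^sub>M MV) MZ (\<lambda>(u, v) z. j u v z) h"
    and p: "cond_density MU MZ (\<lambda>u z. \<integral>\<^sup>+v. j u v z \<partial>MV) p"
    and R: "(\<lambda>(u, z). R u z) \<in> MU \<Otimes>\<^sub>M MZ \<rightarrow>\<^sub>M prob_algebra MZ"
    and rev: "\<And>u. u \<in> space MU \<Longrightarrow> reversible (density MZ (p u)) (R u)"
  defines "S \<equiv> \<lambda>u a b. \<integral>\<^sup>+v. a v * ((\<integral>\<^sup>+z. j u v z \<partial>MZ) *
    (\<integral>\<^sup>+v'. b v' * (\<integral>\<^sup>+z. (\<integral>\<^sup>+z'. k (u, z') v' \<partial>R u z) * h (u, v) z \<partial>MZ) \<partial>MV)) \<partial>MV"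
  shows "AE u in MU. \<forall>a\<in>borel_measurable MV. \<forall>b\<in>borel_measurable MV. S u a b = S u b a"
proof -
  interpret U: sigma_finite_measure MU by fact
  interpret V: sigma_finite_measure MV by fact
  interpret Z: sigma_finite_measure MZ by fact
  interpret UZ: pair_sigma_finite MU MZ ..
  interpret UV: pair_sigma_finite MU MV ..
  interpret VZ: pair_sigma_finite MV MZ ..
  have kM[measurable]: "(\<lambda>(w, v). k w v) \<in> borel_measurable ((MU \<Otimes>\<^sub>M MZ) \<Otimes>\<^sub>M MV)"
    and hM[measurable]: "(\<lambda>(w, z). h w z) \<in> borel_measurable ((MU \<Otimes>\<^sub>M MV) \<Otimes>\<^sub>M MZ)"
    and pM[measurable]: "(\<lambda>(u, z). p u z) \<in> borel_measurable (MU \<Otimes>\<^sub>M MZ)"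
    using k h p by (simp_all add: cond_density_def)
  have [measurable]: "(\<lambda>w. j (fst (fst w)) (snd (fst w)) (snd w)) \<in> borel_measurable ((MU \<Otimes>\<^sub>M MV) \<Otimes>\<^sub>M MZ)"
    "(\<lambda>w. j (fst (fst w)) (snd w) (snd (fst w))) \<in> borel_measurable ((MU \<Otimes>\<^sub>M MZ) \<Otimes>\<^sub>M MV)"
    using measurable_compose[OF _ j, of "\<lambda>((u, v), z). (u, v, z)" "(MU \<Otimes>\<^sub>M MV) \<Otimes>\<^sub>M MZ"]
      measurable_compose[OF _ j, of "\<lambda>((u, z), v). (u, v, z)" "(MU \<Otimes>\<^sub>M MZ) \<Otimes>\<^sub>M MV"]
    by (simp_all add: split_beta')
  have jZ: "(\<lambda>(u, v). \<integral>\<^sup>+z. j u v z \<partial>MZ) \<in> borel_measurable (MU \<Otimes>\<^sub>M MV)"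
    by measurable
  have fubini: "(\<integral>\<^sup>+z. \<integral>\<^sup>+v. j u v z \<partial>MV \<partial>MZ) = (\<integral>\<^sup>+v. \<integral>\<^sup>+z. j u v z \<partial>MZ \<partial>MV)" if "u \<in> space MU" for u
    using that by (intro VZ.Fubini') measurable
  have "AE w in MU \<Otimes>\<^sub>M MV. AE z in MZ. (\<integral>\<^sup>+z'. (\<lambda>(u, v) z. j u v z) w z' \<partial>MZ) * h w z = (\<lambda>(u, v) z. j u v z) w z"
  proof (rule marginal_times_cond_density[OF sf(3) _ _ h])
    show "(\<integral>\<^sup>+w. \<integral>\<^sup>+z. (\<lambda>(u, v) z. j u v z) w z \<partial>MZ \<partial>(MU \<Otimes>\<^sub>M MV)) \<noteq> \<infinity>"
      using fin jZ by (subst V.nn_integral_fst[symmetric]) (simp_all add: split_beta')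
  qed (simp add: split_beta')
  from UV.AE_pair[OF this]
  have H: "AE u in MU. AE v in MV. AE z in MZ. (\<integral>\<^sup>+z. j u v z \<partial>MZ) * h (u, v) z = j u v z"
    by simp
  have "AE w in MU \<Otimes>\<^sub>M MZ. AE v in MV. (\<integral>\<^sup>+v'. (\<lambda>(u, z) v. j u v z) w v' \<partial>MV) * k w v = (\<lambda>(u, z) v. j u v z) w v"
  proof (rule marginal_times_cond_density[OF sf(2) _ _ k])
    show "(\<integral>\<^sup>+w. \<integral>\<^sup>+v. (\<lambda>(u, z) v. j u v z) w v \<partial>MV \<partial>(MU \<Otimes>\<^sub>M MZ)) \<noteq> \<infinity>"
      using fin by (subst Z.nn_integral_fst[symmetric]) (simp_all add: split_beta' fubini cong: nn_integral_cong)
  qed (simp add: split_beta')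
  from UZ.AE_pair[OF this]
  have K: "AE u in MU. AE z in MZ. AE v in MV. (\<integral>\<^sup>+v'. j u v' z \<partial>MV) * k (u, z) v = j u v z"
    by simp
  have P: "AE u in MU. AE z in MZ. (\<integral>\<^sup>+z. \<integral>\<^sup>+v. j u v z \<partial>MV \<partial>MZ) * p u z = (\<integral>\<^sup>+v. j u v z \<partial>MV)"
    using fin by (intro marginal_times_cond_density[OF sf(3) _ _ p]) (simp_all add: fubini cong: nn_integral_cong)
  from H K P AE_space show ?thesis
  proof eventually_elim
    case (elim u)
    note u[measurable] = elim(4)
    have Ru: "R u \<in> MZ \<rightarrow>\<^sub>M subprob_algebra MZ"
      using measurable_compose[OF measurable_Pair1'[OF u] measurable_prob_algebraD[OF R]] by simp
    define q where "q a z = (\<integral>\<^sup>+v. a v * k (u, z) v \<partial>MV)" for a z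
    have q[measurable]: "q a \<in> borel_measurable MZ" if [measurable]: "a \<in> borel_measurable MV" for a
      unfolding q_def by measurable
    have eq: "S u a b = (\<integral>\<^sup>+z. \<integral>\<^sup>+v. j u v z \<partial>MV \<partial>MZ) * (\<integral>\<^sup>+z. q a z * (\<integral>\<^sup>+z'. q b z' \<partial>R u z) \<partial>density MZ (p u))"
      if [measurable]: "a \<in> borel_measurable MV" "b \<in> borel_measurable MV" for a b
      unfolding S_def q_def
      by (rule nn_integral_sandwich_move[OF sf(2,3) _ _ _ _ _ _ _ Ru elim(1,2,3)]) measurable
    have "subprob_algebra (density MZ (p u)) = subprob_algebra MZ"
      by (intro subprob_algebra_cong) simp
    with Ru have "R u \<in> density MZ (p u) \<rightarrow>\<^sub>M subprob_algebra (density MZ (p u))"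
      by (simp cong: measurable_cong_sets)
    note swap = reversible_nn_integral[OF this rev[OF u]]
    show ?case
    proof (intro ballI)
      fix a b :: "'v \<Rightarrow> ennreal" assume ab: "a \<in> borel_measurable MV" "b \<in> borel_measurable MV"
      show "S u a b = S u b a"
        unfolding eq[OF ab] eq[OF ab(2,1)] using swap[of "q a" "q b"] q[OF ab(1)] q[OF ab(2)] by simp
    qed
  qed
qed

lemma borel_measurable_sandwich_density:
  assumes sf: "sigma_finite_measure MZ"
    and [measurable]: "(\<lambda>(w, v). k w v) \<in> borel_measurable ((MU \<Otimes>\<^sub>M MZ) \<Otimes>\<^sub>M MV)"
    and h: "(\<lambda>(w, z). h w z) \<in> borel_measurable ((MU \<Otimes>\<^sub>M MV) \<Otimes>\<^sub>M MZ)"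
    and R: "(\<lambda>(u, z). R u z) \<in> MU \<Otimes>\<^sub>M MZ \<rightarrow>\<^sub>M prob_algebra MZ"
  shows "(\<lambda>(u, v, v'). \<integral>\<^sup>+z. (\<integral>\<^sup>+z'. k (u, z') v' \<partial>R u z) * h (u, v) z \<partial>MZ)
    \<in> borel_measurable (MU \<Otimes>\<^sub>M MV \<Otimes>\<^sub>M MV)"
proof -
  interpret sigma_finite_measure MZ by fact
  note [measurable] = measurable_prob_algebraD[OF R]
  have "(\<lambda>((u, v'), z). \<integral>\<^sup>+z'. k (u, z') v' \<partial>R u z) \<in> borel_measurable ((MU \<Otimes>\<^sub>M MV) \<Otimes>\<^sub>M MZ)"
    unfolding split_beta' by (rule nn_integral_measurable_subprob_algebra2[where N=MZ]) measurable
  from measurable_compose[OF _ this, of "\<lambda>((u, v, v'), z). ((u, v'), z)" "(MU \<Otimes>\<^sub>M MV \<Otimes>\<^sub>M MV) \<Otimes>\<^sub>M MZ"]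
    measurable_compose[OF _ h, of "\<lambda>((u, v, v'), z). ((u, v), z)" "(MU \<Otimes>\<^sub>M MV \<Otimes>\<^sub>M MV) \<Otimes>\<^sub>M MZ"]
  have [measurable]:
    "(\<lambda>((u, v, v'), z). \<integral>\<^sup>+z'. k (u, z') v' \<partial>R u z) \<in> borel_measurable ((MU \<Otimes>\<^sub>M MV \<Otimes>\<^sub>M MV) \<Otimes>\<^sub>M MZ)"
    "(\<lambda>((u, v, v'), z). h (u, v) z) \<in> borel_measurable ((MU \<Otimes>\<^sub>M MV \<Otimes>\<^sub>M MV) \<Otimes>\<^sub>M MZ)"
    by (simp_all add: split_beta')
  have "(\<lambda>(u, v, v'). \<integral>\<^sup>+z. (\<lambda>((u, v, v'), z). \<integral>\<^sup>+z'. k (u, z') v' \<partial>R u z) ((u, v, v'), z) *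
      (\<lambda>((u, v, v'), z). h (u, v) z) ((u, v, v'), z) \<partial>MZ) \<in> borel_measurable (MU \<Otimes>\<^sub>M MV \<Otimes>\<^sub>M MV)"
    by measurable
  then show ?thesis
    by (simp add: split_beta')
qed

section \<open>The mixture of the two moves\<close>

lemma markov_kernel_hss_kernel:
  assumes sf: "sigma_finite_measure MX" "sigma_finite_measure MY" "sigma_finite_measure MZ"
    and X: "cond_density (MY \<Otimes>\<^sub>M MZ) MX jX fX_YZ"
    and Y: "cond_density (MX \<Otimes>\<^sub>M MZ) MY jY fY_XZ"
    and Z: "cond_density (MX \<Otimes>\<^sub>M MY) MZ jZ fZ_XY"
    and R1[measurable]: "(\<lambda>(y, z). R1 y z) \<in> MY \<Otimes>\<^sub>M MZ \<rightarrow>\<^sub>M prob_algebra MZ"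
    and R2[measurable]: "(\<lambda>(x, z). R2 x z) \<in> MX \<Otimes>\<^sub>M MZ \<rightarrow>\<^sub>M prob_algebra MZ"
  shows "markov_kernel (MX \<Otimes>\<^sub>M MY) (hss_kernel MX MY MZ fX_YZ fY_XZ fZ_XY R1 R2 r)"
proof -
  have [measurable]: "(\<lambda>w. density MX (fX_YZ w)) \<in> MY \<Otimes>\<^sub>M MZ \<rightarrow>\<^sub>M prob_algebra MX"
    "(\<lambda>w. density MY (fY_XZ w)) \<in> MX \<Otimes>\<^sub>M MZ \<rightarrow>\<^sub>M prob_algebra MY"
    "(\<lambda>w. density MZ (fZ_XY w)) \<in> MX \<Otimes>\<^sub>M MY \<rightarrow>\<^sub>M prob_algebra MZ"
    using sf X Y Z by (auto intro!: density_prob_algebra simp: cond_density_def)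
  have "uniform_measure lborel {0<..<1 :: real} \<in> space (prob_algebra borel)"
    by (auto simp: space_prob_algebra intro!: prob_space_uniform_measure)
  then have [measurable]: "(\<lambda>_. uniform_measure lborel {0<..<1 :: real}) \<in> N \<rightarrow>\<^sub>M prob_algebra borel" for N :: "(('a \<times> 'b) \<times> 'c) measure"
    by (rule measurable_const)
  show ?thesis
    unfolding markov_kernel_def hss_kernel_def by measurable
qed

text \<open>
  The flow from \<open>A\<close> to \<open>B\<close> splits into the flows of the two moves. That of the \<open>x\<close>-move is
  integrated over \<open>x\<close> first and that of the \<open>y\<close>-move over \<open>y\<close> first, so that in each the
  inner integral is the symmetric form of a move with the outer variable fixed.
\<close>

lemma reversible_hss_kernel:
  assumes sf: "sigma_finite_measure MX" "sigma_finite_measure MY" "sigma_finite_measure MZ"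
    and f: "prob_density (MX \<Otimes>\<^sub>M MY \<Otimes>\<^sub>M MZ) f"
    and X: "cond_density (MY \<Otimes>\<^sub>M MZ) MX (\<lambda>(y, z) x. f (x, y, z)) fX_YZ"
    and Y: "cond_density (MX \<Otimes>\<^sub>M MZ) MY (\<lambda>(x, z) y. f (x, y, z)) fY_XZ"
    and Z: "cond_density (MX \<Otimes>\<^sub>M MY) MZ (\<lambda>(x, y) z. f (x, y, z)) fZ_XY"
    and ZY: "cond_density MY MZ (\<lambda>y z. \<integral>\<^sup>+x. f (x, y, z) \<partial>MX) fZ_Y"
    and ZX: "cond_density MX MZ (\<lambda>x z. \<integral>\<^sup>+y. f (x, y, z) \<partial>MY) fZ_X"
    and R1: "(\<lambda>(y, z). R1 y z) \<in> MY \<Otimes>\<^sub>M MZ \<rightarrow>\<^sub>M prob_algebra MZ"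
    and rev1: "\<And>y. y \<in> space MY \<Longrightarrow> reversible (density MZ (fZ_Y y)) (R1 y)"
    and R2: "(\<lambda>(x, z). R2 x z) \<in> MX \<Otimes>\<^sub>M MZ \<rightarrow>\<^sub>M prob_algebra MZ"
    and rev2: "\<And>x. x \<in> space MX \<Longrightarrow> reversible (density MZ (fZ_X x)) (R2 x)"
    and r: "0 < r" "r < 1"
  shows "reversible (density (MX \<Otimes>\<^sub>M MY) (\<lambda>(x, y). \<integral>\<^sup>+z. f (x, y, z) \<partial>MZ))
    (hss_kernel MX MY MZ fX_YZ fY_XZ fZ_XY R1 R2 r)"
proof -
  interpret X: sigma_finite_measure MX by fact
  interpret Y: sigma_finite_measure MY by fact
  interpret Z: sigma_finite_measure MZ by fact
  interpret XY: pair_sigma_finite MX MY ..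
  interpret YZ: pair_sigma_finite MY MZ ..
  have fM[measurable]: "f \<in> borel_measurable (MX \<Otimes>\<^sub>M MY \<Otimes>\<^sub>M MZ)"
    using f by (simp add: prob_density_def)
  have xyz: "(\<integral>\<^sup>+x. \<integral>\<^sup>+y. \<integral>\<^sup>+z. f (x, y, z) \<partial>MZ \<partial>MY \<partial>MX) = 1"
  proof -
    have "(\<integral>\<^sup>+x. \<integral>\<^sup>+y. \<integral>\<^sup>+z. f (x, y, z) \<partial>MZ \<partial>MY \<partial>MX) = (\<integral>\<^sup>+x. \<integral>\<^sup>+w. f (x, w) \<partial>(MY \<Otimes>\<^sub>M MZ) \<partial>MX)"
      by (intro nn_integral_cong Z.nn_integral_fst) measurable
    also have "\<dots> = 1"
      using f YZ.nn_integral_fst[OF fM] by (simp add: prob_density_def)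
    finally show ?thesis .
  qed
  define \<kappa>1 where "\<kappa>1 x' x y = k1 MZ fX_YZ fZ_XY R1 x' x y" for x' x y
  define \<kappa>2 where "\<kappa>2 y' y x = k2 MZ fY_XZ fZ_XY R2 y' y x" for y' y x
  define m where "m x y = (\<integral>\<^sup>+z. f (x, y, z) \<partial>MZ)" for x y
  have [measurable]: "(\<lambda>(x, y). m x y) \<in> borel_measurable (MX \<Otimes>\<^sub>M MY)"
    unfolding m_def by measurable
  \<comment> \<open>For the move of \<open>x\<close> the fixed component is \<open>y\<close>, so \<open>y\<close> has to come first.\<close>
  note Z' = cond_density_swap[of MX MY MZ "\<lambda>x y z. f (x, y, z)" "\<lambda>x y. fZ_XY (x, y)", simplified, OF Z]
  have kernels: "(\<lambda>(y, x, x'). \<kappa>1 x' x y) \<in> borel_measurable (MY \<Otimes>\<^sub>M MX \<Otimes>\<^sub>M MX)"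
    "(\<lambda>(x, y, y'). \<kappa>2 y' y x) \<in> borel_measurable (MX \<Otimes>\<^sub>M MY \<Otimes>\<^sub>M MY)"
    using borel_measurable_sandwich_density[OF sf(3) _ _ R1, of fX_YZ MX "\<lambda>(y, x). fZ_XY (x, y)"] X Z'
      borel_measurable_sandwich_density[OF sf(3) _ _ R2, of fY_XZ MY fZ_XY] Y Z
    by (simp_all add: \<kappa>1_def \<kappa>2_def k1_def k2_def cond_density_def)
  have [measurable]: "(\<lambda>w. \<kappa>1 (snd w) (fst (fst w)) (snd (fst w))) \<in> borel_measurable ((MX \<Otimes>\<^sub>M MY) \<Otimes>\<^sub>M MX)"
    using measurable_compose[OF _ kernels(1), of "\<lambda>((x, y), x'). (y, x, x')" "(MX \<Otimes>\<^sub>M MY) \<Otimes>\<^sub>M MX"]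
    by (simp add: split_beta')
  have [measurable]: "(\<lambda>w. \<kappa>2 (snd w) (snd (fst w)) (fst (fst w))) \<in> borel_measurable ((MX \<Otimes>\<^sub>M MY) \<Otimes>\<^sub>M MY)"
    using measurable_compose[OF _ kernels(2), of "\<lambda>((x, y), y'). (x, y, y')" "(MX \<Otimes>\<^sub>M MY) \<Otimes>\<^sub>M MY"]
    by (simp add: split_beta')
  \<comment> \<open>The stationary flow from \<open>A\<close> to \<open>B\<close> under the move of one component, as a density in the
    value of the other.\<close>
  define S1 where "S1 A B y = (\<integral>\<^sup>+x. indicator A (x, y) * (m x y * (\<integral>\<^sup>+x'. indicator B (x', y) * \<kappa>1 x' x y \<partial>MX)) \<partial>MX)"
    for A B :: "('a \<times> 'b) set" and y
  define S2 where "S2 A B x = (\<integral>\<^sup>+y. indicator A (x, y) * (m x y * (\<integral>\<^sup>+y'. indicator B (x, y') * \<kappa>2 y' y x \<partial>MY)) \<partial>MY)"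
    for A B :: "('a \<times> 'b) set" and x
  have flow: "(\<integral>\<^sup>+s\<in>A. emeasure (hss_kernel MX MY MZ fX_YZ fY_XZ fZ_XY R1 R2 r s) B
        \<partial>density (MX \<Otimes>\<^sub>M MY) (\<lambda>(x, y). m x y)) =
      ennreal r * (\<integral>\<^sup>+y. S1 A B y \<partial>MY) + ennreal (1 - r) * (\<integral>\<^sup>+x. S2 A B x \<partial>MX)"
    if [measurable]: "A \<in> sets (MX \<Otimes>\<^sub>M MY)" "B \<in> sets (MX \<Otimes>\<^sub>M MY)" for A B
  proof -
    define T1 where "T1 = (\<lambda>(x, y). indicator A (x, y) * (m x y * (\<integral>\<^sup>+x'. indicator B (x', y) * \<kappa>1 x' x y \<partial>MX)))"
    define T2 where "T2 = (\<lambda>(x, y). indicator A (x, y) * (m x y * (\<integral>\<^sup>+y'. indicator B (x, y') * \<kappa>2 y' y x \<partial>MY)))"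
    have [measurable]: "T1 \<in> borel_measurable (MX \<Otimes>\<^sub>M MY)" "T2 \<in> borel_measurable (MX \<Otimes>\<^sub>M MY)"
      unfolding T1_def T2_def by measurable
    let ?K = "hss_kernel MX MY MZ fX_YZ fY_XZ fZ_XY R1 R2 r"
    have [measurable]: "(\<lambda>s. emeasure (?K s) B) \<in> borel_measurable (MX \<Otimes>\<^sub>M MY)"
      using markov_kernel_hss_kernel[OF sf X Y Z R1 R2, of r] that(2)
      unfolding markov_kernel_def
      by (intro measurable_compose[OF measurable_prob_algebraD measurable_emeasure_subprob_algebra])
    have "(\<integral>\<^sup>+s\<in>A. emeasure (?K s) B \<partial>density (MX \<Otimes>\<^sub>M MY) (\<lambda>(x, y). m x y)) =
        (\<integral>\<^sup>+s. (\<lambda>(x, y). m x y) s * (emeasure (?K s) B * indicator A s) \<partial>(MX \<Otimes>\<^sub>M MY))"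
      by (rule nn_integral_density) measurable
    also have "\<dots> = (\<integral>\<^sup>+s. ennreal r * T1 s + ennreal (1 - r) * T2 s \<partial>(MX \<Otimes>\<^sub>M MY))"
      using emeasure_hss_kernel[OF sf X Y Z R1 R2 r _ _ that(2), folded \<kappa>1_def \<kappa>2_def]
      by (intro nn_integral_cong) (auto simp: space_pair_measure T1_def T2_def algebra_simps)
    also have "\<dots> = ennreal r * (\<integral>\<^sup>+s. T1 s \<partial>(MX \<Otimes>\<^sub>M MY)) + ennreal (1 - r) * (\<integral>\<^sup>+s. T2 s \<partial>(MX \<Otimes>\<^sub>M MY))"
      by (simp add: nn_integral_add nn_integral_cmult)
    also have "(\<integral>\<^sup>+s. T1 s \<partial>(MX \<Otimes>\<^sub>M MY)) = (\<integral>\<^sup>+y. S1 A B y \<partial>MY)"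
      by (subst XY.nn_integral_snd[symmetric]) (simp_all add: T1_def S1_def[abs_def])
    also have "(\<integral>\<^sup>+s. T2 s \<partial>(MX \<Otimes>\<^sub>M MY)) = (\<integral>\<^sup>+x. S2 A B x \<partial>MX)"
      by (subst Y.nn_integral_fst[symmetric]) (simp_all add: T2_def S2_def[abs_def])
    finally show ?thesis .
  qed
  have db1: "AE y in MY. \<forall>A\<in>sets (MX \<Otimes>\<^sub>M MY). \<forall>B\<in>sets (MX \<Otimes>\<^sub>M MY). S1 A B y = S1 B A y"
  proof -
    have "(\<integral>\<^sup>+y. \<integral>\<^sup>+x. \<integral>\<^sup>+z. f (x, y, z) \<partial>MZ \<partial>MX \<partial>MY) = 1"
      unfolding xyz[symmetric] by (rule XY.Fubini') measurable
    then have "AE y in MY. \<forall>a\<in>borel_measurable MX. \<forall>b\<in>borel_measurable MX.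
        (\<integral>\<^sup>+x. a x * (m x y * (\<integral>\<^sup>+x'. b x' * \<kappa>1 x' x y \<partial>MX)) \<partial>MX) =
        (\<integral>\<^sup>+x. b x * (m x y * (\<integral>\<^sup>+x'. a x' * \<kappa>1 x' x y \<partial>MX)) \<partial>MX)"
      unfolding m_def \<kappa>1_def k1_def
      using sandwich_move_detailed_balance[OF sf(2,1,3) _ _ X Z' ZY R1 rev1] by simp
    with AE_space show ?thesis
    proof eventually_elim
      case (elim y)
      have meas: "(\<lambda>x. indicator A (x, y) :: ennreal) \<in> borel_measurable MX" if "A \<in> sets (MX \<Otimes>\<^sub>M MY)" for A
        using that elim(1) by measurable
      show ?case
        unfolding S1_def by (intro ballI elim(2)[rule_format, OF meas meas])
    qed
  qed
  have db2: "AE x in MX. \<forall>A\<in>sets (MX \<Otimes>\<^sub>M MY). \<forall>B\<in>sets (MX \<Otimes>\<^sub>M MY). S2 A B x = S2 B A x"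
  proof -
    have "AE x in MX. \<forall>a\<in>borel_measurable MY. \<forall>b\<in>borel_measurable MY.
        (\<integral>\<^sup>+y. a y * (m x y * (\<integral>\<^sup>+y'. b y' * \<kappa>2 y' y x \<partial>MY)) \<partial>MY) =
        (\<integral>\<^sup>+y. b y * (m x y * (\<integral>\<^sup>+y'. a y' * \<kappa>2 y' y x \<partial>MY)) \<partial>MY)"
      unfolding m_def \<kappa>2_def k2_def
      using sandwich_move_detailed_balance[OF sf _ _ Y Z ZX R2 rev2] xyz by simp
    with AE_space show ?thesis
    proof eventually_elim
      case (elim x)
      have meas: "(\<lambda>y. indicator A (x, y) :: ennreal) \<in> borel_measurable MY" if "A \<in> sets (MX \<Otimes>\<^sub>M MY)" for A
        using that elim(1) by measurable
      show ?case
        unfolding S2_def by (intro ballI elim(2)[rule_format, OF meas meas])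
    qed
  qed
  have "(\<integral>\<^sup>+y. S1 A B y \<partial>MY) = (\<integral>\<^sup>+y. S1 B A y \<partial>MY)" "(\<integral>\<^sup>+x. S2 A B x \<partial>MX) = (\<integral>\<^sup>+x. S2 B A x \<partial>MX)"
    if "A \<in> sets (MX \<Otimes>\<^sub>M MY)" "B \<in> sets (MX \<Otimes>\<^sub>M MY)" for A B
    by (rule nn_integral_cong_AE, use db1 in eventually_elim, use that in blast)
      (rule nn_integral_cong_AE, use db2 in eventually_elim, use that in blast)
  then show ?thesis
    unfolding reversible_def m_def[symmetric] by (simp add: flow)
qed

theorem proposition1:
  fixes X :: "'a::euclidean_space set"
    and Y :: "'b::euclidean_space set"
    and Z :: "'c::euclidean_space set"
    and f :: "'a \<times> 'b \<times> 'c \<Rightarrow> ennreal"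
    and fX_YZ :: "'b \<times> 'c \<Rightarrow> 'a \<Rightarrow> ennreal"
    and fY_XZ :: "'a \<times> 'c \<Rightarrow> 'b \<Rightarrow> ennreal"
    and fZ_XY :: "'a \<times> 'b \<Rightarrow> 'c \<Rightarrow> ennreal"
    and fZ_Y :: "'b \<Rightarrow> 'c \<Rightarrow> ennreal"
    and fZ_X :: "'a \<Rightarrow> 'c \<Rightarrow> ennreal"
    and R1 :: "'b \<Rightarrow> 'c \<Rightarrow> 'c measure"
    and R2 :: "'a \<Rightarrow> 'c \<Rightarrow> 'c measure"
    and r :: real
  assumes "X \<in> sets borel" and "Y \<in> sets borel" and "Z \<in> sets borel"
    and "prob_density (lborel_on X \<Otimes>\<^sub>M lborel_on Y \<Otimes>\<^sub>M lborel_on Z) f"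
    and "cond_density (lborel_on Y \<Otimes>\<^sub>M lborel_on Z) (lborel_on X) (\<lambda>(y, z) x. f (x, y, z)) fX_YZ"
    and "cond_density (lborel_on X \<Otimes>\<^sub>M lborel_on Z) (lborel_on Y) (\<lambda>(x, z) y. f (x, y, z)) fY_XZ"
    and "cond_density (lborel_on X \<Otimes>\<^sub>M lborel_on Y) (lborel_on Z) (\<lambda>(x, y) z. f (x, y, z)) fZ_XY"
    and "cond_density (lborel_on Y) (lborel_on Z) (\<lambda>y z. \<integral>\<^sup>+x. f (x, y, z) \<partial>lborel_on X) fZ_Y"
    and "cond_density (lborel_on X) (lborel_on Z) (\<lambda>x z. \<integral>\<^sup>+y. f (x, y, z) \<partial>lborel_on Y) fZ_X"
    and "(\<lambda>(y, z). R1 y z) \<in> lborel_on Y \<Otimes>\<^sub>M lborel_on Z \<rightarrow>\<^sub>M prob_algebra (lborel_on Z)"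
    and "\<And>y. y \<in> Y \<Longrightarrow> reversible (density (lborel_on Z) (fZ_Y y)) (R1 y)"
    and "(\<lambda>(x, z). R2 x z) \<in> lborel_on X \<Otimes>\<^sub>M lborel_on Z \<rightarrow>\<^sub>M prob_algebra (lborel_on Z)"
    and "\<And>x. x \<in> X \<Longrightarrow> reversible (density (lborel_on Z) (fZ_X x)) (R2 x)"
    and "0 < r" and "r < 1"
  shows "markov_kernel (lborel_on X \<Otimes>\<^sub>M lborel_on Y)
           (hss_kernel (lborel_on X) (lborel_on Y) (lborel_on Z) fX_YZ fY_XZ fZ_XY R1 R2 r) \<and>
         reversible (density (lborel_on X \<Otimes>\<^sub>M lborel_on Y) (\<lambda>(x, y). \<integral>\<^sup>+z. f (x, y, z) \<partial>lborel_on Z))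
           (hss_kernel (lborel_on X) (lborel_on Y) (lborel_on Z) fX_YZ fY_XZ fZ_XY R1 R2 r)"
proof
  have sf: "sigma_finite_measure (lborel_on S)" if "S \<in> sets borel" for S :: "'d::euclidean_space set"
    using that by (intro sigma_finite_measure_restrict_space) (simp_all add: lborel.sigma_finite_measure_axioms)
  note sf' = sf[OF assms(1)] sf[OF assms(2)] sf[OF assms(3)]
  show "markov_kernel (lborel_on X \<Otimes>\<^sub>M lborel_on Y)
      (hss_kernel (lborel_on X) (lborel_on Y) (lborel_on Z) fX_YZ fY_XZ fZ_XY R1 R2 r)"
    by (rule markov_kernel_hss_kernel[OF sf' assms(5-7,10,12)])
  show "reversible (density (lborel_on X \<Otimes>\<^sub>M lborel_on Y) (\<lambda>(x, y). \<integral>\<^sup>+z. f (x, y, z) \<partial>lborel_on Z))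
      (hss_kernel (lborel_on X) (lborel_on Y) (lborel_on Z) fX_YZ fY_XZ fZ_XY R1 R2 r)"
    by (rule reversible_hss_kernel[OF sf' assms(4-10) _ assms(12) _ assms(14,15)])
      (rule assms(11,13), simp add: space_restrict_space)+
qed

end
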